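(* Let $m$ and $n$ be positive integers with $n\geq 2m$, and let $s:=\lfloor\log_2(n/m)\rfloor$. Let $$(\boldsymbol{M}_1,\ldots,\boldsymbol{M}_s),\ (\boldsymbol{N}_1,\ldots,\boldsymbol{N}_s)\in\left\{\begin{bmatrix}1&0\\1&1\end{bmatrix},\begin{bmatrix}0&1\\-1&2\end{bmatrix}\right\}^s$$ be two ordered collections of matrices, and put $$\mathbf{M}:=\prod_{i=1}^{s}\boldsymbol{M}_{s-i+1}=\boldsymbol{M}_s\boldsymbol{M}_{s-1}\cdots\boldsymbol{M}_1,\qquad \mathbf{N}:=\prod_{i=1}^{s}\boldsymbol{N}_{s-i+1}=\boldsymbol{N}_s\boldsymbol{N}_{s-1}\cdots\boldsymbol{N}_1 .$$ Then $\mathbf{M}\cdot\mathcal{F}_m$ and $\mathbf{N}\cdot\mathcal{F}_m$ are subsequences of the Farey sequence $\mathcal{F}_n$, and the following hold. (1) The map $$\mathbf{M}\cdot\mathcal{F}_m\to\mathbf{N}\cdot\mathcal{F}_m,\qquad \begin{bmatrix}h\\k\end{bmatrix}\mapsto\mathbf{N}\cdot\mathbf{M}^{-1}\cdot\begin{bmatrix}h\\k\end{bmatrix},$$ is order-preserving and bijective. (2) The map $$\mathbf{M}\cdot\mathcal{F}_m\to\mathbf{N}\cdot\mathcal{F}_m,\qquad \begin{bmatrix}h\\k\end{bmatrix}\mapsto\mathbf{N}\cdot\begin{bmatrix}-1&1\\0&1\end{bmatrix}\cdot\mathbf{M}^{-1}\cdot\begin{bmatrix}h\\k\end{bmatrix},$$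 is order-reversing and bijective. (3) In particular, the map $$\mathbf{M}\cdot\mathcal{F}_m\to\mathbf{M}\cdot\mathcal{F}_m,\qquad \begin{bmatrix}h\\k\end{bmatrix}\mapsto\mathbf{M}\cdot\begin{bmatrix}-1&1\\0&1\end{bmatrix}\cdot\mathbf{M}^{-1}\cdot\begin{bmatrix}h\\k\end{bmatrix},$$ is order-reversing and bijective, the matrix $\mathbf{M}\cdot\begin{bmatrix}-1&1\\0&1\end{bmatrix}\cdot\mathbf{M}^{-1}$ is involutory (its square is the identity matrix), and if $m>1$ then $\mathbf{M}\cdot\begin{bmatrix}1\\2\end{bmatrix}$ is a fixed point of this map.
   Context: For a positive integer $n$, the Farey sequence $\mathcal{F}_n$ of order $n$ is the increasing sequence of all irreducible fractions $\frac{h}{k}$ with $0\leq h\leq k\leq n$, $k\geq 1$, $\gcd(h,k)=1$; it includes $\frac{0}{1}$ and $\frac{1}{1}$. The irreducible fraction $\frac{h}{k}$ is identified with the column vector $\begin{bmatrix}h\\k\end{bmatrix}$, and the order on vectors is the usual order on the corresponding fractions. For a matrix $\boldsymbol{S}\in\mathrm{SL}(2,\mathbb{Z})$ and a sequence $\mathcal{C}$ of irreducible fractions written in vector form, $\boldsymbol{S}\cdot\mathcal{C}$ denotes the sequence of vectors $\boldsymbol{S}\cdot\begin{bmatrix}h\\k\end{bmatrix}$ with $\begin{bmatrix}h\\k\end{bmatrix}\in\mathcal{C}$. *)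

theory Defs
  imports "HOL-Analysis.Analysis" "HOL-Library.Sublist"
begin

abbreviation mat22 :: "int \<Rightarrow> int \<Rightarrow> int \<Rightarrow> int \<Rightarrow> int^2^2" where
  "mat22 a b c d \<equiv> vector [vector [a, b], vector [c, d]]"

definition farey_fractions :: "nat \<Rightarrow> rat set" where
  "farey_fractions n =
     {of_int h / of_int k | h k :: int. 0 \<le> h \<and> h \<le> k \<and> k \<le> int n \<and> 1 \<le> k \<and> coprime h k}"

text \<open>\<^const>\<open>quotient_of\<close> returns numerator and (positive) denominator in lowest terms.\<close>

definition frac_vec :: "rat \<Rightarrow> int^2" where
  "frac_vec q = vector [fst (quotient_of q), snd (quotient_of q)]"

definition farey_seq :: "nat \<Rightarrow> (int^2) list" where
  "farey_seq n = map frac_vec (sorted_list_of_set (farey_fractions n))"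

definition mat_seq :: "int^2^2 \<Rightarrow> (int^2) list \<Rightarrow> (int^2) list" where
  "mat_seq S C = map (\<lambda>v. S *v v) C"

definition vec_frac :: "int^2 \<Rightarrow> rat" where
  "vec_frac v = of_int (v $ 1) / of_int (v $ 2)"

text \<open>The order of the represented fractions, not the componentwise order on vectors.\<close>

definition frac_le :: "int^2 \<Rightarrow> int^2 \<Rightarrow> bool" where
  "frac_le u v \<longleftrightarrow> vec_frac u \<le> vec_frac v"

definition order_preserving_on :: "(int^2) set \<Rightarrow> (int^2 \<Rightarrow> int^2) \<Rightarrow> bool" where
  "order_preserving_on A f \<longleftrightarrow> monotone_on A frac_le frac_le f"

definition order_reversing_on :: "(int^2) set \<Rightarrow> (int^2 \<Rightarrow> int^2) \<Rightarrow> bool" where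
  "order_reversing_on A f \<longleftrightarrow> monotone_on A frac_le (\<lambda>u v. frac_le v u) f"

text \<open>For \<open>[M\<^sub>1, \<dots>, M\<^sub>s]\<close> this is \<open>M\<^sub>s ** \<dots> ** M\<^sub>1\<close>: later factors are multiplied on the left.\<close>

definition rev_matrix_prod :: "(int^2^2) list \<Rightarrow> int^2^2" where
  "rev_matrix_prod Ms = fold (\<lambda>A P. A ** P) Ms (mat 1)"

lemma finite_farey_fractions: "finite (farey_fractions n)"
proof (rule finite_subset)
  show "farey_fractions n \<subseteq>
      (\<lambda>(h, k). of_int h / of_int k) ` ({0..int n} \<times> {0..int n})"
    unfolding farey_fractions_def by force
qed simp

lemma set_farey_seq:
  "set (farey_seq n) =
     {vector [h, k] | h k. 0 \<le> h \<and> h \<le> k \<and> k \<le> int n \<and> 1 \<le> k \<and> coprime h k}"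
proof -
  have "frac_vec (of_int h / of_int k) = vector [h, k]" if "1 \<le> k" "coprime h k" for h k :: int
    using that by (simp add: frac_vec_def flip: Fract_of_int_quotient)
                  (simp add: quotient_of_Fract normalize_def)
  then show ?thesis
    unfolding farey_seq_def
    by (simp add: finite_farey_fractions) (force simp: farey_fractions_def image_iff)
qed

lemma sorted_farey_seq: "sorted_wrt (\<lambda>u v. vec_frac u < vec_frac v) (farey_seq n)"
proof -
  have "vec_frac (frac_vec q) = q" for q
    using quotient_of_div [of q "fst (quotient_of q)" "snd (quotient_of q)"]
    by (simp add: vec_frac_def frac_vec_def)
  then show ?thesis
    by (simp add: farey_seq_def sorted_wrt_map)
qed

end

theory Submission
  imports Defs
begin

text \<open>
  Both generators have determinant 1 and map the Farey vectors of order \<open>m\<close> to Farey vectors of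
  order \<open>2 m\<close>, so a product of \<open>s\<close> of them maps \<open>\<F>\<^sub>m\<close> into the Farey vectors of order
  \<open>2\<^sup>s m \<le> n\<close>. For vectors with positive denominators the order of fractions is the sign of
  a \<open>2 \<times> 2\<close> determinant, hence it is preserved by matrices of determinant 1 and reversed by those
  of determinant \<open>-1\<close>, such as the matrix of the reflection \<open>x \<mapsto> 1 - x\<close>, which permutes
  \<open>\<F>\<^sub>m\<close>. The claims follow by conjugation.
\<close>

abbreviation (input) farey_gens :: "(int^2^2) set" where
  "farey_gens \<equiv> {mat22 1 0 1 1, mat22 0 1 (-1) 2}"

abbreviation (input) reflection :: "int^2^2" where
  "reflection \<equiv> mat22 (-1) 1 0 1"

lemma matrix_vector_mult_2:
  fixes S :: "'a::comm_semiring_1^2^2"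
  shows "(S *v v) $ 1 = S$1$1 * v$1 + S$1$2 * v$2" "(S *v v) $ 2 = S$2$1 * v$1 + S$2$2 * v$2"
  by (simp_all add: matrix_vector_mult_def sum_2)

text \<open>Induction on \<open>ys\<close> compares the two heads: equal heads are matched, and
  otherwise the head of \<open>ys\<close> lies strictly below all of \<open>xs\<close> and can be
  skipped. This reduces the subsequence claim to an inclusion of sets.\<close>

lemma subseq_sorted_wrt:
  assumes "transp R" "irreflp R" "sorted_wrt R xs" "sorted_wrt R ys" "set xs \<subseteq> set ys"
  shows "subseq xs ys"
  using assms(3-)
proof (induction ys arbitrary: xs)
  case Nil
  then show ?case by simp
next
  case (Cons y ys)
  show ?case
  proof (cases xs)
    case Nil
    then show ?thesis by simp
  next
    case xs: (Cons x xs')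
    show ?thesis
    proof (cases "x = y")
      case True
      have "y \<notin> set xs'"
        using Cons.prems(1) xs True assms(2) by (auto dest: irreflpD)
      then have "subseq xs' ys"
        using Cons.prems xs by (intro Cons.IH) auto
      then show ?thesis using xs True by simp
    next
      case False
      \<comment> \<open>As \<open>x\<close> is in \<open>ys\<close>, \<open>y\<close> precedes it;
        an occurrence of \<open>y\<close> in \<open>xs\<close> would then yield
        \<open>R x y\<close>, hence \<open>R y y\<close>.\<close>
      then have "R y x"
        using Cons.prems xs by auto
      then have "y \<notin> set xs"
        using Cons.prems(1) xs assms(1,2) by (auto dest: irreflpD transpD)
      then have "subseq xs ys"
        using Cons.prems by (intro Cons.IH) auto
      then show ?thesis by auto
    qed
  qed
qed

section \<open>Farey vectors in coordinates and the order as a determinant sign\<close>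

lemma in_set_farey_seq_iff:
  "v \<in> set (farey_seq m) \<longleftrightarrow>
     0 \<le> v$1 \<and> v$1 \<le> v$2 \<and> v$2 \<le> int m \<and> 1 \<le> v$2 \<and> coprime (v$1) (v$2)"
proof -
  have "v = vector [h, k] \<longleftrightarrow> h = v$1 \<and> k = v$2" for h k
    by (auto simp: vec_eq_iff forall_2)
  then show ?thesis
    by (auto simp: set_farey_seq)
qed

lemma farey_seq_mono: "m \<le> n \<Longrightarrow> set (farey_seq m) \<subseteq> set (farey_seq n)"
  by (auto simp: in_set_farey_seq_iff)

lemma vec_frac_le_iff:
  assumes "u$2 > 0" "v$2 > 0"
  shows "vec_frac u \<le> vec_frac v \<longleftrightarrow> u$1 * v$2 \<le> v$1 * u$2"
proof -
  have "vec_frac u \<le> vec_frac v \<longleftrightarrow>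
      (of_int (u$1) * of_int (v$2) :: rat) \<le> of_int (v$1) * of_int (u$2)"
    using assms by (simp add: vec_frac_def field_simps)
  then show ?thesis by (simp flip: of_int_mult)
qed

text \<open>Multiplicativity of the determinant, applied to \<open>S\<close> times the matrix with
  columns \<open>u\<close> and \<open>v\<close>. For positive denominators, \<open>u\<close> is at
  most \<open>v\<close> as a fraction iff the column determinant is at most 0.\<close>

lemma det_columns_mult:
  fixes S :: "int^2^2"
  shows "(S *v u)$1 * (S *v v)$2 - (S *v v)$1 * (S *v u)$2 = det S * (u$1 * v$2 - v$1 * u$2)"
  by (simp add: matrix_vector_mult_2 det_2 algebra_simps)

lemma frac_le_mult:
  assumes "det S = 1" "u$2 > 0" "v$2 > 0" "(S *v u)$2 > 0" "(S *v v)$2 > 0"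
  shows "frac_le (S *v u) (S *v v) \<longleftrightarrow> frac_le u v"
  using det_columns_mult[of S u v] assms by (simp add: frac_le_def vec_frac_le_iff) linarith

lemma frac_le_mult_rev:
  assumes "det S = - 1" "u$2 > 0" "v$2 > 0" "(S *v u)$2 > 0" "(S *v v)$2 > 0"
  shows "frac_le (S *v u) (S *v v) \<longleftrightarrow> frac_le v u"
  using det_columns_mult[of S u v] assms by (simp add: frac_le_def vec_frac_le_iff) linarith

section \<open>Generators and their products\<close>

lemma gen_maps_farey:
  assumes "S \<in> farey_gens" "v \<in> set (farey_seq m)"
  shows "S *v v \<in> set (farey_seq (2 * m))"
proof -
  have "coprime (v$1) (v$2)"
    using assms(2) by (simp add: in_set_farey_seq_iff)
  moreover from this have "coprime (v$1) (v$1 + v$2)"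
    by (simp add: coprime_iff_gcd_eq_1)
  moreover have "coprime (v$2) (2 * v$2 - v$1)"
  proof (rule coprimeI)
    fix d assume "d dvd v$2" "d dvd 2 * v$2 - v$1"
    \<comment> \<open>The difference is \<open>v$1\<close>, so \<open>d\<close> is a common divisor
      of the original coordinates.\<close>
    then have "d dvd 2 * v$2 - (2 * v$2 - v$1)"
      by (metis dvd_diff dvd_mult)
    then show "is_unit d"
      using \<open>d dvd v$2\<close> \<open>coprime (v$1) (v$2)\<close> by (auto dest: coprime_common_divisor)
  qed
  \<comment> \<open>The images of \<open>(h, k)\<close> are \<open>(h, h + k)\<close> and
    \<open>(k, 2k - h)\<close>; as \<open>0 \<le> h \<le> k\<close>, both denominators lie between
    \<open>k\<close> and \<open>2k\<close>.\<close>
  ultimately show ?thesis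
    using assms by (auto simp: in_set_farey_seq_iff matrix_vector_mult_2)
qed

lemma rev_matrix_prod_snoc: "rev_matrix_prod (Ms @ [S]) = S ** rev_matrix_prod Ms"
  by (simp add: rev_matrix_prod_def)

text \<open>Later factors act on the left, so induction from the end of the list peels off the
  outermost generator, which at most doubles the Farey order.\<close>

lemma rev_matrix_prod_gens:
  assumes "set Ms \<subseteq> farey_gens"
  shows "det (rev_matrix_prod Ms) = 1"
    and "invertible (rev_matrix_prod Ms)"
    and "v \<in> set (farey_seq m) \<Longrightarrow>
           rev_matrix_prod Ms *v v \<in> set (farey_seq (2 ^ length Ms * m))"
  using assms
proof (induction Ms rule: rev_induct)
  case Nil
  {
    case 1
    show ?case by (simp add: rev_matrix_prod_def)
  next
    case 2
    show ?case by (auto simp: rev_matrix_prod_def invertible_def)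
  next
    case 3
    then show ?case by (simp add: rev_matrix_prod_def)
  }
next
  case (snoc S Ms)
  {
    case 1
    then have "det S = 1" "det (rev_matrix_prod Ms) = 1"
      using snoc.IH(1) by (auto simp: det_2)
    then show ?case
      by (simp add: rev_matrix_prod_snoc det_mul)
  next
    case 2
    \<comment> \<open>The inverses are the adjugates, which are integral because the determinant is
      1.\<close>
    have "mat22 1 0 1 1 ** mat22 1 0 (-1) 1 = mat 1" "mat22 1 0 (-1) 1 ** mat22 1 0 1 1 = mat 1"
      "mat22 0 1 (-1) 2 ** mat22 2 (-1) 1 0 = mat 1" "mat22 2 (-1) 1 0 ** mat22 0 1 (-1) 2 = mat 1"
      by (simp_all add: vec_eq_iff forall_2 matrix_matrix_mult_def sum_2 mat_def)
    then have "invertible S"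
      using 2 unfolding invertible_def by auto
    then show ?case
      using 2 snoc.IH(2) by (simp add: rev_matrix_prod_snoc invertible_mult)
  next
    case 3
    then have "rev_matrix_prod Ms *v v \<in> set (farey_seq (2 ^ length Ms * m))"
      by (intro snoc.IH(3)) auto
    moreover have "S \<in> farey_gens"
      using 3 by auto
    ultimately have "S *v (rev_matrix_prod Ms *v v) \<in> set (farey_seq (2 * (2 ^ length Ms * m)))"
      by (intro gen_maps_farey)
    then show ?case
      by (simp add: rev_matrix_prod_snoc matrix_vector_mul_assoc mult.assoc)
  }
qed

section \<open>Maps of the form \<open>N ** J ** matrix_inv M\<close>\<close>

lemma matrix_inv_cancel:
  assumes "invertible M"
  shows "matrix_inv M ** M = mat 1" "M ** matrix_inv M = mat 1"
  using assms unfolding invertible_def matrix_inv_def by (auto intro: someI2_ex)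

lemma inj_matrix_vector_mult:
  fixes M :: "'a::comm_semiring_1^'n^'n"
  assumes "invertible M"
  shows "inj ((*v) M)"
  using matrix_inv_cancel(1)[OF assms]
  by (intro injI) (metis matrix_vector_mul_assoc matrix_vector_mul_lid)

text \<open>The inverse cancels \<open>M\<close>, so questions about the map on \<open>M\<close>
  times a set become questions about \<open>J\<close> on the set itself. The theorem uses
  \<open>J = mat 1\<close> and \<open>J = reflection\<close>.\<close>

lemma conj_matrix_apply:
  fixes M N J :: "'a::comm_semiring_1^'n^'n"
  assumes "invertible M"
  shows "(N ** J ** matrix_inv M) *v (M *v v) = N *v (J *v v)"
  using matrix_inv_cancel(1)[OF assms]
  by (metis matrix_vector_mul_assoc matrix_vector_mul_lid)

lemma bij_betw_conj_matrix:
  fixes M N J :: "'a::comm_semiring_1^'n^'n"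
  assumes "invertible M" "invertible N" "bij_betw ((*v) J) X X"
  shows "bij_betw ((*v) (N ** J ** matrix_inv M)) ((*v) M ` X) ((*v) N ` X)"
proof (rule bij_betw_imageI)
  have "inj_on ((*v) J) X" "(*v) J ` X = X"
    using assms(3) by (auto simp: bij_betw_def)
  then have "inj_on ((*v) N \<circ> (*v) J) X"
    using inj_matrix_vector_mult[OF assms(2)] by (auto intro: comp_inj_on inj_on_subset)
  then show "inj_on ((*v) (N ** J ** matrix_inv M)) ((*v) M ` X)"
    by (intro inj_on_imageI) (simp add: o_def conj_matrix_apply[OF assms(1)])
  have "(*v) (N ** J ** matrix_inv M) ` (*v) M ` X = (*v) N ` ((*v) J ` X)"
    by (simp add: image_image conj_matrix_apply[OF assms(1)])
  then show "(*v) (N ** J ** matrix_inv M) ` (*v) M ` X = (*v) N ` X"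
    using \<open>(*v) J ` X = X\<close> by simp
qed

section \<open>The reflection and its conjugates\<close>

lemma reflection_square: "reflection ** reflection = mat 1"
  by (simp add: vec_eq_iff forall_2 matrix_matrix_mult_def sum_2 mat_def)

lemma reflection_maps_farey:
  assumes "v \<in> set (farey_seq m)"
  shows "reflection *v v \<in> set (farey_seq m)"
proof -
  have "coprime (v$2 - v$1) (v$2)"
    using assms by (simp add: in_set_farey_seq_iff coprime_iff_gcd_eq_1 gcd_diff2)
  then show ?thesis
    using assms by (auto simp: in_set_farey_seq_iff matrix_vector_mult_2)
qed

lemma bij_betw_reflection_farey:
  "bij_betw ((*v) reflection) (set (farey_seq m)) (set (farey_seq m))"
  by (rule bij_betw_byWitness[where f' = "(*v) reflection"])
     (auto simp: matrix_vector_mul_assoc reflection_square reflection_maps_farey)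

lemma involution_conj_reflection:
  assumes "invertible M"
  shows "(M ** reflection ** matrix_inv M) ** (M ** reflection ** matrix_inv M) = mat 1"
proof -
  have "(M ** reflection ** matrix_inv M) ** (M ** reflection ** matrix_inv M) =
      M ** reflection ** (matrix_inv M ** M) ** reflection ** matrix_inv M"
    by (simp only: matrix_mul_assoc)
  \<comment> \<open>The inner product \<open>matrix_inv M ** M\<close> collapses, leaving the square
    of the reflection.\<close>
  also have "\<dots> = M ** (reflection ** reflection) ** matrix_inv M"
    by (simp add: matrix_inv_cancel[OF assms] matrix_mul_assoc)
  finally show ?thesis
    by (simp add: reflection_square matrix_inv_cancel[OF assms])
qed

section \<open>Order and subsequence claims for the products\<close>

lemma farey_seq_denom_pos: "v \<in> set (farey_seq m) \<Longrightarrow> v$2 > 0"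
  by (simp add: in_set_farey_seq_iff)

lemma frac_le_rev_matrix_prod:
  assumes "set Ms \<subseteq> farey_gens" "u \<in> set (farey_seq m)" "v \<in> set (farey_seq m)"
  shows "frac_le (rev_matrix_prod Ms *v u) (rev_matrix_prod Ms *v v) \<longleftrightarrow> frac_le u v"
  \<comment> \<open>The images are again Farey vectors, of a larger order, so their denominators are
    positive too.\<close>
  using rev_matrix_prod_gens[OF assms(1)] assms(2,3)
  by (intro frac_le_mult) (auto intro: farey_seq_denom_pos)

lemma frac_le_reflection:
  assumes "u \<in> set (farey_seq m)" "v \<in> set (farey_seq m)"
  shows "frac_le (reflection *v u) (reflection *v v) \<longleftrightarrow> frac_le v u"
  using assms
  by (intro frac_le_mult_rev) (auto simp: det_2 intro: farey_seq_denom_pos reflection_maps_farey)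

lemma subseq_rev_matrix_prod_farey:
  assumes "set Ms \<subseteq> farey_gens" "2 ^ length Ms * m \<le> n"
  shows "subseq (mat_seq (rev_matrix_prod Ms) (farey_seq m)) (farey_seq n)"
proof (rule subseq_sorted_wrt)
  show "transp (\<lambda>u v. vec_frac u < vec_frac v)" "irreflp (\<lambda>u v. vec_frac u < vec_frac v)"
    by (auto intro!: transpI irreflpI)
  show "sorted_wrt (\<lambda>u v. vec_frac u < vec_frac v) (farey_seq n)"
    by (rule sorted_farey_seq)
  show "sorted_wrt (\<lambda>u v. vec_frac u < vec_frac v) (mat_seq (rev_matrix_prod Ms) (farey_seq m))"
    unfolding mat_seq_def sorted_wrt_map
    \<comment> \<open>Strict inequalities transfer as negations of the reversed weak ones, for which
      an equivalence is available.\<close>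
    by (rule sorted_wrt_mono_rel[OF _ sorted_farey_seq])
       (use frac_le_rev_matrix_prod[OF assms(1)] in \<open>auto simp: frac_le_def simp flip: not_le\<close>)
  show "set (mat_seq (rev_matrix_prod Ms) (farey_seq m)) \<subseteq> set (farey_seq n)"
    using rev_matrix_prod_gens(3)[OF assms(1)] farey_seq_mono[OF assms(2)]
    by (auto simp: mat_seq_def)
qed

lemma order_preserving_conj:
  assumes "set Ms \<subseteq> farey_gens" "set Ns \<subseteq> farey_gens"
  shows "order_preserving_on ((*v) (rev_matrix_prod Ms) ` set (farey_seq m))
           ((*v) (rev_matrix_prod Ns ** matrix_inv (rev_matrix_prod Ms)))"
  using conj_matrix_apply[OF rev_matrix_prod_gens(2)[OF assms(1)], of _ "mat 1"]
  by (auto simp: order_preserving_on_def monotone_on_def frac_le_rev_matrix_prod assms)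

lemma order_reversing_conj:
  assumes "set Ms \<subseteq> farey_gens" "set Ns \<subseteq> farey_gens"
  shows "order_reversing_on ((*v) (rev_matrix_prod Ms) ` set (farey_seq m))
           ((*v) (rev_matrix_prod Ns ** reflection ** matrix_inv (rev_matrix_prod Ms)))"
  unfolding order_reversing_on_def
proof (rule monotone_onI, clarify)
  fix u v
  assume uv: "u \<in> set (farey_seq m)" "v \<in> set (farey_seq m)"
    and "frac_le (rev_matrix_prod Ms *v u) (rev_matrix_prod Ms *v v)"
  then have "frac_le (reflection *v v) (reflection *v u)"
    by (simp add: frac_le_rev_matrix_prod[OF assms(1)] frac_le_reflection)
  then show "frac_le
      ((rev_matrix_prod Ns ** reflection ** matrix_inv (rev_matrix_prod Ms)) *v (rev_matrix_prod Ms *v v))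
      ((rev_matrix_prod Ns ** reflection ** matrix_inv (rev_matrix_prod Ms)) *v (rev_matrix_prod Ms *v u))"
    using uv
    by (simp add: conj_matrix_apply rev_matrix_prod_gens(2)[OF assms(1)] reflection_maps_farey
        frac_le_rev_matrix_prod[OF assms(2), where m = m])
qed

lemma power_two_floor_log_le:
  fixes m n :: nat
  assumes "0 < m" "m \<le> n"
  shows "2 ^ nat \<lfloor>log 2 (real n / real m)\<rfloor> * m \<le> n"
proof -
  define L where "L = log 2 (real n / real m)"
  \<comment> \<open>This ensures that \<open>nat\<close> does not truncate the floor.\<close>
  have "0 \<le> L"
    using assms by (simp add: L_def)
  have "(2::real) ^ nat \<lfloor>L\<rfloor> = 2 powr real (nat \<lfloor>L\<rfloor>)"
    by (simp add: powr_realpow)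
  also have "\<dots> \<le> 2 powr L"
    using \<open>0 \<le> L\<close> by (intro powr_mono) auto
  also have "\<dots> = real n / real m"
    using assms by (simp add: L_def)
  finally have "2 ^ nat \<lfloor>L\<rfloor> * real m \<le> real n"
    using assms by (simp add: field_simps)
  then have "real (2 ^ nat \<lfloor>L\<rfloor> * m) \<le> real n"
    by simp
  then show ?thesis
    unfolding L_def of_nat_le_iff .
qed

theorem theorem10:
  fixes m n s :: nat
    and Ms Ns :: "(int^2^2) list"
    and M N :: "int^2^2"
  assumes "m > 0" and "n > 0" and "n \<ge> 2 * m"
    and "s = nat \<lfloor>log 2 (real n / real m)\<rfloor>"
    and "length Ms = s" and "set Ms \<subseteq> {mat22 1 0 1 1, mat22 0 1 (-1) 2}"
    and "length Ns = s" and "set Ns \<subseteq> {mat22 1 0 1 1, mat22 0 1 (-1) 2}"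
    and "M = rev_matrix_prod Ms" and "N = rev_matrix_prod Ns"
  shows
    "subseq (mat_seq M (farey_seq m)) (farey_seq n) \<and>
     subseq (mat_seq N (farey_seq m)) (farey_seq n) \<and>
     (let f = (\<lambda>v. (N ** matrix_inv M) *v v);
          A = set (mat_seq M (farey_seq m));
          B = set (mat_seq N (farey_seq m))
      in order_preserving_on A f \<and> bij_betw f A B) \<and>
     (let f = (\<lambda>v. (N ** mat22 (-1) 1 0 1 ** matrix_inv M) *v v);
          A = set (mat_seq M (farey_seq m));
          B = set (mat_seq N (farey_seq m))
      in order_reversing_on A f \<and> bij_betw f A B) \<and>
     (let T = M ** mat22 (-1) 1 0 1 ** matrix_inv M;
          f = (\<lambda>v. T *v v);
          A = set (mat_seq M (farey_seq m))
      in order_reversing_on A f \<and> bij_betw f A A \<and>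
         T ** T = mat 1 \<and>
         (m > 1 \<longrightarrow> M *v vector [1, 2] \<in> A \<and> f (M *v vector [1, 2]) = M *v vector [1, 2]))"
proof -
  let ?F = "set (farey_seq m)"
  have gens: "set Ms \<subseteq> farey_gens" "set Ns \<subseteq> farey_gens"
    using assms by auto
  have len: "2 ^ length Ms * m \<le> n" "2 ^ length Ns * m \<le> n"
    using power_two_floor_log_le[of m n] assms by auto
  have inv: "invertible M" "invertible N"
    using rev_matrix_prod_gens(2) gens assms by auto
  have set_eq: "set (mat_seq S (farey_seq m)) = (*v) S ` ?F" for S
    by (simp add: mat_seq_def)
  have sub: "subseq (mat_seq M (farey_seq m)) (farey_seq n)"
      "subseq (mat_seq N (farey_seq m)) (farey_seq n)"
    using subseq_rev_matrix_prod_farey gens len assms by auto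
  \<comment> \<open>The first map is the case \<open>J = mat 1\<close> of the general form.\<close>
  have "bij_betw ((*v) (mat 1)) ?F ?F"
    by (simp add: bij_betw_def inj_on_def)
  from bij_betw_conj_matrix[OF inv this]
  have bij1: "bij_betw ((*v) (N ** matrix_inv M)) ((*v) M ` ?F) ((*v) N ` ?F)"
    by simp
  note bij2 = bij_betw_conj_matrix[OF inv bij_betw_reflection_farey[of m]]
  note bij3 = bij_betw_conj_matrix[OF inv(1) inv(1) bij_betw_reflection_farey[of m]]
  have ord: "order_preserving_on ((*v) M ` ?F) ((*v) (N ** matrix_inv M))"
      "order_reversing_on ((*v) M ` ?F) ((*v) (N ** reflection ** matrix_inv M))"
      "order_reversing_on ((*v) M ` ?F) ((*v) (M ** reflection ** matrix_inv M))"
    using order_preserving_conj order_reversing_conj gens assms by auto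
  have "(M ** reflection ** matrix_inv M) *v (M *v vector [1, 2]) = M *v vector [1, 2]"
  proof -
    \<comment> \<open>The fraction 1/2 is the fixed point of \<open>x \<mapsto> 1 - x\<close>; it
      belongs to the Farey sequence of order \<open>m\<close> once \<open>m > 1\<close>.\<close>
    have "reflection *v vector [1, 2] = vector [1, 2]"
      by (simp add: vec_eq_iff forall_2 matrix_vector_mult_2)
    then show ?thesis
      by (simp add: conj_matrix_apply inv)
  qed
  moreover have "m > 1 \<longrightarrow> M *v vector [1, 2] \<in> (*v) M ` ?F"
    by (auto simp: in_set_farey_seq_iff)
  ultimately show ?thesis
    unfolding Let_def set_eq
    using sub bij1 bij2 bij3 ord involution_conj_reflection[OF inv(1)] by blast
qed

end
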